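(* Fix $\alpha,\beta,\gamma,\kappa,\delta>0$, $\bar S>0$, and $\omega\ge 0$, and suppose the optimal policies are interior. The optimal usage policy with the worker skill externality $\omega$ is $$u^*(\omega,S)=u_0-u_\omega\,\omega+u_1S,$$ where $$u_\omega=\frac{\kappa\bar S}{\gamma\delta+\sqrt{[\kappa((\beta-1)\bar S+2\gamma)+\gamma\delta]^2-\kappa^2(\beta-1)^2\bar S^2}}>0$$ and $u_0,u_1$ are the coefficients of the optimal policy $u_0+u_1S$ without the externality. At $\omega=0$ the worker's and the firm's policies coincide. The steady-state skill level is $$\hat S(\omega)=\frac{\bar S(1-u_0+u_\omega\omega)}{1+u_1\bar S},$$ which is strictly increasing in $\omega$ when the interior steady state is stable ($1+u_1\bar S>0$).
   Context: A worker has skill $S_t\in[0,\bar S]$; usage is $u_t\in[0,1]$. Skill evolves by $\dot S=\kappa\bar S(1-u)-\kappa S$. Flow productivity is $p(S,u)=(1-u)S+[\alpha+\beta S-\gamma u]u$. With the worker skill externality, the worker's flow payoff is $p(S,u)+\omega S$, and the worker's optimal policy $u^*(\omega,\cdot)$ maximizes $\int_0^\infty e^{-\delta t}[p(S_t,u_t)+\omega S_t]\,dt$; the value function satisfies the Bellman equation $\delta V(S)=\max_u\{p(S,u)+\omega S+V'(S)[\kappa\bar S(1-u)-\kappa S]\}$. The firm has the same discount rate $\delta$ but ignores the externality (it uses $\omega=0$). Interior policy means $0<u^*<1$, so that the first-order condition in the Bellman equation holds. The interior solution for $\omega=0$ has $V(S)=aS^2+bS+c$ and $u^*(S)=u_0+u_1S$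 with $$u_0=\frac{\alpha-\kappa b\bar S}{2\gamma},\quad u_1=\frac{\beta-1-2\kappa a\bar S}{2\gamma},$$ where, with $D=[\kappa((\beta-1)\bar S+2\gamma)+\gamma\delta]^2-\kappa^2(\beta-1)^2\bar S^2>0$ (stable root), $$a=\frac{\kappa((\beta-1)\bar S+2\gamma)+\gamma\delta-\sqrt D}{2\kappa^2\bar S^2},\qquad b=\frac{2\gamma(1+2a\kappa\bar S)+\alpha(\beta-1-2\kappa a\bar S)}{2(\delta+\kappa)\gamma+\kappa(\beta-1)\bar S-2\kappa^2a\bar S^2}.$$ For $\omega>0$ the quadratic solution with the same (stable) root for the $S^2$-coefficient is used. The steady-state skill is the zero of $\dot S$ under the policy. *)

theory Defs
  imports "HOL-Analysis.Analysis"
begin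

definition productivity :: "real \<Rightarrow> real \<Rightarrow> real \<Rightarrow> real \<Rightarrow> real \<Rightarrow> real" where
  "productivity \<alpha> \<beta> \<gamma> S u = (1 - u) * S + (\<alpha> + \<beta> * S - \<gamma> * u) * u"

definition skill_drift :: "real \<Rightarrow> real \<Rightarrow> real \<Rightarrow> real \<Rightarrow> real" where
  "skill_drift \<kappa> Sbar S u = \<kappa> * Sbar * (1 - u) - \<kappa> * S"

text \<open>Controls are measurable functions of time; the state equation is imposed in integral form,
  so that it holds at almost every time for an absolutely continuous skill path.
  Values at negative times are irrelevant.\<close>

definition admissible ::
    "real \<Rightarrow> real \<Rightarrow> real \<Rightarrow> (real \<Rightarrow> real) \<Rightarrow> (real \<Rightarrow> real) \<Rightarrow> bool" where
  "admissible \<kappa> Sbar S0 S u \<longleftrightarrow>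
     set_borel_measurable lborel {0..} u \<and>
     (\<forall>t\<ge>0. u t \<in> {0..1} \<and> S t \<in> {0..Sbar} \<and>
        ((\<lambda>s. skill_drift \<kappa> Sbar (S s) (u s)) has_integral (S t - S0)) {0..t})"

text \<open>The flow payoff \<open>f\<close> takes skill and usage. It is \<^const>\<open>productivity\<close> for the firm;
  the worker adds the externality term. For continuous \<open>f\<close> the integrand is bounded by a
  multiple of \<open>exp (- \<delta> * t)\<close> along admissible paths, hence integrable.\<close>

definition discounted_payoff ::
    "real \<Rightarrow> (real \<Rightarrow> real \<Rightarrow> real) \<Rightarrow> (real \<Rightarrow> real) \<Rightarrow> (real \<Rightarrow> real) \<Rightarrow> real" where
  "discounted_payoff \<delta> f S u = (LBINT t:{0..}. exp (- \<delta> * t) * f (S t) (u t))"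

text \<open>A policy is a continuous feedback rule on the skill range. Without continuity an optimal
  policy would not be pinned down pointwise: changing it at a single skill level that is left
  immediately alters neither the skill path nor the payoff.\<close>

definition optimal_policy ::
    "real \<Rightarrow> real \<Rightarrow> real \<Rightarrow> (real \<Rightarrow> real \<Rightarrow> real) \<Rightarrow> (real \<Rightarrow> real) \<Rightarrow> bool" where
  "optimal_policy \<kappa> \<delta> Sbar f pol \<longleftrightarrow>
     continuous_on {0..Sbar} pol \<and>
     (\<forall>S0\<in>{0..Sbar}. \<exists>S. admissible \<kappa> Sbar S0 S (\<lambda>t. pol (S t)) \<and>
        (\<forall>X v. admissible \<kappa> Sbar S0 X v \<longrightarrow>
           discounted_payoff \<delta> f X v \<le> discounted_payoff \<delta> f S (\<lambda>t. pol (S t))))"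

definition interior_policy :: "real \<Rightarrow> (real \<Rightarrow> real) \<Rightarrow> bool" where
  "interior_policy Sbar pol \<longleftrightarrow> (\<forall>S\<in>{0..Sbar}. 0 < pol S \<and> pol S < 1)"

definition worker_payoff :: "real \<Rightarrow> real \<Rightarrow> real \<Rightarrow> real \<Rightarrow> real \<Rightarrow> real \<Rightarrow> real" where
  "worker_payoff \<alpha> \<beta> \<gamma> \<omega> S u = productivity \<alpha> \<beta> \<gamma> S u + \<omega> * S"

definition is_steady_state :: "real \<Rightarrow> real \<Rightarrow> (real \<Rightarrow> real) \<Rightarrow> real \<Rightarrow> bool" where
  "is_steady_state \<kappa> Sbar pol S \<longleftrightarrow> S \<in> {0..Sbar} \<and> skill_drift \<kappa> Sbar S (pol S) = 0"

definition steady_state_skill :: "real \<Rightarrow> real \<Rightarrow> (real \<Rightarrow> real) \<Rightarrow> real" where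
  "steady_state_skill \<kappa> Sbar pol = (THE S. is_steady_state \<kappa> Sbar pol S)"

text \<open>Coefficients of the quadratic value function \<open>a * S\<^sup>2 + b * S + c\<close> without externality:
  \<open>Ddisc\<close> is the discriminant (up to a constant factor) of the quadratic equation for \<open>a\<close>,
  whose smaller root is the stable one.\<close>

definition Ddisc :: "real \<Rightarrow> real \<Rightarrow> real \<Rightarrow> real \<Rightarrow> real \<Rightarrow> real" where
  "Ddisc \<beta> \<gamma> \<kappa> \<delta> Sbar =
     (\<kappa> * ((\<beta> - 1) * Sbar + 2 * \<gamma>) + \<gamma> * \<delta>)\<^sup>2 - \<kappa>\<^sup>2 * (\<beta> - 1)\<^sup>2 * Sbar\<^sup>2"

definition acoef :: "real \<Rightarrow> real \<Rightarrow> real \<Rightarrow> real \<Rightarrow> real \<Rightarrow> real" where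
  "acoef \<beta> \<gamma> \<kappa> \<delta> Sbar =
     (\<kappa> * ((\<beta> - 1) * Sbar + 2 * \<gamma>) + \<gamma> * \<delta> - sqrt (Ddisc \<beta> \<gamma> \<kappa> \<delta> Sbar)) / (2 * \<kappa>\<^sup>2 * Sbar\<^sup>2)"

definition bcoef :: "real \<Rightarrow> real \<Rightarrow> real \<Rightarrow> real \<Rightarrow> real \<Rightarrow> real \<Rightarrow> real" where
  "bcoef \<alpha> \<beta> \<gamma> \<kappa> \<delta> Sbar =
     (let a = acoef \<beta> \<gamma> \<kappa> \<delta> Sbar in
       (2 * \<gamma> * (1 + 2 * a * \<kappa> * Sbar) + \<alpha> * (\<beta> - 1 - 2 * \<kappa> * a * Sbar)) /
       (2 * (\<delta> + \<kappa>) * \<gamma> + \<kappa> * (\<beta> - 1) * Sbar - 2 * \<kappa>\<^sup>2 * a * Sbar\<^sup>2))"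

definition u0_coef :: "real \<Rightarrow> real \<Rightarrow> real \<Rightarrow> real \<Rightarrow> real \<Rightarrow> real \<Rightarrow> real" where
  "u0_coef \<alpha> \<beta> \<gamma> \<kappa> \<delta> Sbar = (\<alpha> - \<kappa> * bcoef \<alpha> \<beta> \<gamma> \<kappa> \<delta> Sbar * Sbar) / (2 * \<gamma>)"

definition u1_coef :: "real \<Rightarrow> real \<Rightarrow> real \<Rightarrow> real \<Rightarrow> real \<Rightarrow> real" where
  "u1_coef \<beta> \<gamma> \<kappa> \<delta> Sbar = (\<beta> - 1 - 2 * \<kappa> * acoef \<beta> \<gamma> \<kappa> \<delta> Sbar * Sbar) / (2 * \<gamma>)"

definition uomega_coef :: "real \<Rightarrow> real \<Rightarrow> real \<Rightarrow> real \<Rightarrow> real \<Rightarrow> real" where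
  "uomega_coef \<beta> \<gamma> \<kappa> \<delta> Sbar = \<kappa> * Sbar / (\<gamma> * \<delta> + sqrt (Ddisc \<beta> \<gamma> \<kappa> \<delta> Sbar))"

end

theory Submission
  imports Defs "HOL-Real_Asymp.Real_Asymp"
begin

text \<open>Since the optimal path is interior, it can be perturbed freely on compact time intervals. The
  payoff is quadratic in the size of the perturbation, so its linear coefficient vanishes, and the
  du Bois-Reymond lemma turns this into a second-order linear equation for \<open>S\<close> with characteristic
  roots \<open>(\<delta> \<mp> sqrt D / \<gamma>) / 2\<close>. The larger root is positive, so boundedness of \<open>S\<close> and \<open>S'\<close> removes the
  corresponding mode: along the path \<open>S'\<close> is an affine function of \<open>S\<close> whose coefficients do not depend
  on the starting point. Evaluated at time 0 for every starting point, this is the affine policy.\<close>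

section \<open>Calculus of variations and linear differential equations\<close>

text \<open>The variation \<open>h\<close>, the primitive of \<open>g\<close>, vanishes at both
  ends, so integration by parts trades \<open>F\<close> for minus its primitive \<open>P\<close>.
  Hence \<open>G - P\<close> is orthogonal to every continuous function of mean zero. Testing with
  \<open>G - P\<close> minus its own mean \<open>c\<close> makes the integral of a continuous square
  vanish.\<close>

lemma du_bois_reymond:
  fixes F G :: "real \<Rightarrow> real"
  assumes T: "0 < T" and F: "continuous_on {0..T} F" and G: "continuous_on {0..T} G"
    and var: "\<And>g. continuous_on {0..T} g \<Longrightarrow> integral {0..T} g = 0 \<Longrightarrow>
      integral {0..T} (\<lambda>t. F t * integral {0..t} g + G t * g t) = 0"
  shows "\<exists>c. \<forall>t\<in>{0..T}. G t = c + integral {0..t} F"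
proof -
  define P where "P t = integral {0..t} F" for t
  define c where "c = integral {0..T} (\<lambda>t. G t - P t) / T"
  define g where "g t = G t - P t - c" for t
  define h where "h t = integral {0..t} g" for t
  have dP: "(P has_real_derivative F t) (at t within {0..T})" if "t \<in> {0..T}" for t
    unfolding P_def using integral_has_real_derivative[OF F that] .
  have cP: "continuous_on {0..T} P"
    using dP DERIV_continuous_on by blast
  have cg: "continuous_on {0..T} g"
    unfolding g_def by (intro continuous_intros G cP)
  have dh: "(h has_real_derivative g t) (at t within {0..T})" if "t \<in> {0..T}" for t
    unfolding h_def using integral_has_real_derivative[OF cg that] .
  have ch: "continuous_on {0..T} h"
    using dh DERIV_continuous_on by blast
  have int: "f integrable_on {0..T}" if "continuous_on {0..T} f" for f :: "real \<Rightarrow> real"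
    using that by (rule integrable_continuous_real)
  have cGP: "continuous_on {0..T} (\<lambda>t. G t - P t)"
    by (intro continuous_intros G cP)
  have g0: "integral {0..T} g = 0"
    unfolding g_def using T
    by (subst integral_diff) (auto intro!: int cGP simp: c_def)
  have hT: "h T = 0" and h0: "h 0 = 0"
    by (simp_all add: h_def g0)
  have "((\<lambda>t. F t * h t + P t * g t) has_integral (P T * h T - P 0 * h 0)) {0..T}"
    using T by (intro fundamental_theorem_of_calculus)
      (auto intro!: derivative_eq_intros dP dh simp flip: has_real_derivative_iff_has_vector_derivative)
  then have 1: "((\<lambda>t. F t * h t + P t * g t) has_integral 0) {0..T}"
    by (simp add: hT h0)
  have "(\<lambda>t. F t * h t + G t * g t) integrable_on {0..T}"
    by (intro int continuous_intros F G ch cg)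
  then have 2: "((\<lambda>t. F t * h t + G t * g t) has_integral 0) {0..T}"
    using var[OF cg g0] unfolding h_def has_integral_integral by simp
  have 3: "((\<lambda>t. c * g t) has_integral c * 0) {0..T}"
    using int[OF cg] g0 by (intro has_integral_mult_right) (simp add: has_integral_integral)
  have 4: "((\<lambda>t. g t * g t) has_integral 0) {0..T}"
    using has_integral_diff[OF has_integral_diff[OF 2 1] 3]
    by (rule has_integral_eq_rhs[OF has_integral_eq, rotated]) (auto simp: g_def algebra_simps)
  have g: "g t * g t = 0" if "t \<in> {0..T}" for t
    using has_integral_0_cbox_imp_0[of 0 T "\<lambda>t. g t * g t" t] 4 T that
    by (auto intro!: continuous_intros cg simp: box_real)
  have "G t = c + integral {0..t} F" if "t \<in> {0..T}" for t
    using g[OF that] by (simp add: g_def P_def)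
  then show ?thesis by blast
qed

lemma quadratic_max_imp_linear_coeff_zero:
  fixes A B e :: real
  assumes e: "0 < e" and le: "\<And>x. \<bar>x\<bar> \<le> e \<Longrightarrow> x * A + x\<^sup>2 * B \<le> 0"
  shows "A = 0"
proof (rule ccontr)
  assume A: "A \<noteq> 0"
  have d: "((\<lambda>x. x * A + x\<^sup>2 * B) has_real_derivative A) (at 0)"
    by (auto intro!: derivative_eq_intros)
  have "A = 0"
    by (rule DERIV_local_max[OF d e]) (use le in auto)
  with A show False ..
qed

text \<open>Every solution is the constant \<open>- K / l\<close> plus a multiple of
  \<open>exp (l * t)\<close>. The factor \<open>y\<close> is that multiple; it is constant in time,
  and boundedness of \<open>z\<close> squeezes it under a decaying exponential, so it is 0. This
  takes the place of a transversality condition.\<close>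

lemma bounded_linear_ode_initial:
  fixes z :: "real \<Rightarrow> real"
  assumes l: "0 < l"
    and d: "\<And>T t. 0 < T \<Longrightarrow> t \<in> {0..T} \<Longrightarrow>
      (z has_real_derivative l * z t + K) (at t within {0..T})"
    and b: "\<And>t. 0 \<le> t \<Longrightarrow> \<bar>z t\<bar> \<le> M"
  shows "z 0 = - K / l"
proof -
  define y where "y t = (z t + K / l) * exp (- l * t)" for t
  have const: "y t = y 0" if "0 < t" for t
  proof -
    have "(y has_real_derivative 0) (at s within {0..t})" if "s \<in> {0..t}" for s
      unfolding y_def using l d[OF \<open>0 < t\<close> that]
      by (auto intro!: derivative_eq_intros simp: field_simps)
    then obtain c where "\<forall>s\<in>{0..t}. y s = c"
      using has_field_derivative_zero_constant[of "{0..t}" y] by (auto simp: convex_real_interval)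
    then show ?thesis using \<open>0 < t\<close> by simp
  qed
  have "((\<lambda>t. (M + \<bar>K / l\<bar>) * exp (- l * t)) \<longlongrightarrow> 0) at_top"
    using l by real_asymp
  moreover have "\<forall>\<^sub>F t in at_top. \<bar>y 0\<bar> \<le> (M + \<bar>K / l\<bar>) * exp (- l * t)"
  proof (rule eventually_mono[OF eventually_gt_at_top[of 0]])
    fix t :: real assume "0 < t"
    then have "\<bar>y 0\<bar> = \<bar>z t + K / l\<bar> * exp (- l * t)"
      using const[of t] by (metis y_def abs_mult abs_exp_cancel)
    also have "\<dots> \<le> (M + \<bar>K / l\<bar>) * exp (- l * t)"
      using b[of t] \<open>0 < t\<close> abs_triangle_ineq[of "z t" "K / l"]
      by (intro mult_right_mono) (linarith, simp)
    finally show "\<bar>y 0\<bar> \<le> (M + \<bar>K / l\<bar>) * exp (- l * t)" .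
  qed
  ultimately have "\<bar>y 0\<bar> \<le> 0"
    by (intro tendsto_lowerbound[of _ 0 at_top]) auto
  then show ?thesis by (simp add: y_def)
qed

section \<open>State equation, flow payoff and admissible paths\<close>

text \<open>With the integrating factor \<open>exp (\<kappa> * t)\<close>, both \<open>X\<close> and
  \<open>Sbar - X\<close> become nondecreasing as soon as usage lies in \<open>{0..1}\<close>. For a
  perturbed path the skill constraint thus follows from the usage constraint.\<close>

lemma skill_path_bounds:
  fixes X v :: "real \<Rightarrow> real"
  assumes "0 \<le> \<kappa>" "0 \<le> Sbar"
    and d: "\<And>t. t \<in> {0..T} \<Longrightarrow>
      (X has_real_derivative skill_drift \<kappa> Sbar (X t) (v t)) (at t within {0..T})"
    and v: "\<And>t. t \<in> {0..T} \<Longrightarrow> v t \<in> {0..1}"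
    and X0: "X 0 \<in> {0..Sbar}" and t: "t \<in> {0..T}"
  shows "X t \<in> {0..Sbar}"
proof -
  have d1: "((\<lambda>t. exp (\<kappa> * t) * X t) has_real_derivative
      exp (\<kappa> * s) * (\<kappa> * Sbar * (1 - v s))) (at s within {0..T})" if "s \<in> {0..T}" for s
    using d[OF that] by (auto intro!: derivative_eq_intros simp: skill_drift_def algebra_simps)
  have d2: "((\<lambda>t. exp (\<kappa> * t) * (Sbar - X t)) has_real_derivative
      exp (\<kappa> * s) * (\<kappa> * Sbar * v s)) (at s within {0..T})" if "s \<in> {0..T}" for s
    using d[OF that] by (auto intro!: derivative_eq_intros simp: skill_drift_def algebra_simps)
  have mono: "f 0 \<le> f t"
    if "\<And>s. s \<in> {0..T} \<Longrightarrow> (f has_real_derivative f' s) (at s within {0..T})"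
      and "\<And>s. s \<in> {0..T} \<Longrightarrow> 0 \<le> f' s" for f f' :: "real \<Rightarrow> real"
  proof (rule DERIV_nonneg_imp_increasing_open[of 0 t f])
    show "0 \<le> t" using t by simp
    show "continuous_on {0..t} f"
      using t by (intro continuous_on_subset[OF DERIV_continuous_on[OF that(1)]]) auto
    fix s assume "0 < s" "s < t"
    then show "\<exists>y. (f has_real_derivative y) (at s) \<and> 0 \<le> y"
      using that(1)[of s] that(2)[of s] t by (intro exI[of _ "f' s"]) (auto simp: at_within_Icc_at)
  qed
  have "0 \<le> exp (\<kappa> * t) * X t"
    using order_trans[OF _ mono[OF d1]] X0 v assms(1,2) by simp
  moreover have "0 \<le> exp (\<kappa> * t) * (Sbar - X t)"
    using order_trans[OF _ mono[OF d2]] X0 v assms(1,2) by simp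
  ultimately show ?thesis by (simp add: zero_le_mult_iff)
qed

text \<open>The payoff is a polynomial of degree two in skill and usage, so this Taylor expansion is
  exact. It has no \<open>h * h\<close> term because the payoff has no square of skill.\<close>

lemma worker_payoff_expand:
  "worker_payoff \<alpha> \<beta> \<gamma> \<omega> (S + e * h) (u + e * k) =
    worker_payoff \<alpha> \<beta> \<gamma> \<omega> S u
    + e * ((1 + \<omega> + (\<beta> - 1) * u) * h + (\<alpha> + (\<beta> - 1) * S - 2 * \<gamma> * u) * k)
    + e\<^sup>2 * ((\<beta> - 1) * h * k - \<gamma> * k\<^sup>2)"
  by (simp add: worker_payoff_def productivity_def power2_eq_square algebra_simps)

lemma admissible_continuous_on:
  assumes "admissible \<kappa> Sbar S0 S u"
  shows "continuous_on {0..} S"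
proof -
  have int: "((\<lambda>s. skill_drift \<kappa> Sbar (S s) (u s)) has_integral (S t - S0)) {0..t}" if "0 \<le> t" for t
    using assms that by (simp add: admissible_def)
  have "continuous_on {0..T} S" for T
  proof (cases "0 \<le> T")
    case True
    have "continuous_on {0..T} (\<lambda>t. S0 + integral {0..t} (\<lambda>s. skill_drift \<kappa> Sbar (S s) (u s)))"
      using int[OF True]
      by (intro continuous_intros indefinite_integral_continuous_1) auto
    also have "?this \<longleftrightarrow> ?thesis"
      by (intro continuous_on_cong) (auto dest!: int simp: integral_unique)
    finally show ?thesis .
  qed auto
  \<comment> \<open>Continuity is local: near \<open>t\<close> the half-line and the compact
    interval \<open>{0..t + 1}\<close> coincide.\<close>
  moreover have "at t within {0..} = at t within {0..t + 1}" for t :: real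
    by (rule at_within_nhd[of _ "{..<t + 1}"]) auto
  ultimately show ?thesis
    by (metis atLeastAtMost_iff atLeast_iff continuous_on_eq_continuous_within less_add_one less_imp_le)
qed

text \<open>The initial condition is hidden in the integral equation: at time 0 it is an integral
  over a single point.\<close>

lemma admissible_initial:
  assumes "admissible \<kappa> Sbar S0 S u"
  shows "S 0 = S0"
proof -
  have "((\<lambda>s. skill_drift \<kappa> Sbar (S s) (u s)) has_integral (S 0 - S0)) {0}"
    using assms unfolding admissible_def by (metis atLeastAtMost_singleton order_refl)
  then show ?thesis
    by (metis eq_iff_diff_eq_0 has_integral_refl(2) has_integral_unique)
qed

section \<open>First-order conditions along an interior optimal path\<close>

text \<open>The feedback rule is forgotten and only the usage it generates over time is kept.
  Competitors, by contrast, may use any measurable control.\<close>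

locale optimal_interior_path =
  fixes \<alpha> \<beta> \<gamma> \<kappa> \<delta> Sbar \<omega> :: real and S u :: "real \<Rightarrow> real"
  assumes pos: "0 < \<gamma>" "0 < \<kappa>" "0 < \<delta>" "0 < Sbar"
    and adm: "admissible \<kappa> Sbar (S 0) S u"
    and cont_u: "continuous_on {0..} u"
    and interior: "\<And>t. 0 \<le> t \<Longrightarrow> 0 < u t \<and> u t < 1"
    and opt: "\<And>X v. admissible \<kappa> Sbar (S 0) X v \<Longrightarrow>
      discounted_payoff \<delta> (worker_payoff \<alpha> \<beta> \<gamma> \<omega>) X v
        \<le> discounted_payoff \<delta> (worker_payoff \<alpha> \<beta> \<gamma> \<omega>) S u"
begin

abbreviation drift :: "real \<Rightarrow> real" where
  "drift t \<equiv> skill_drift \<kappa> Sbar (S t) (u t)"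

text \<open>\<open>pay_S\<close> and \<open>pay_u\<close> are the partial derivatives of the flow
  payoff in skill and in usage, taken along the path.\<close>

definition pay_S :: "real \<Rightarrow> real" where
  "pay_S t = 1 + \<omega> + (\<beta> - 1) * u t"

definition pay_u :: "real \<Rightarrow> real" where
  "pay_u t = \<alpha> + (\<beta> - 1) * S t - 2 * \<gamma> * u t"

lemma S_range: "0 \<le> t \<Longrightarrow> S t \<in> {0..Sbar}"
  and drift_integral: "0 \<le> t \<Longrightarrow> (drift has_integral (S t - S 0)) {0..t}"
  using adm by (auto simp: admissible_def)

lemma cont_S: "continuous_on {0..} S"
  using adm by (rule admissible_continuous_on)

lemma continuous_pay [continuous_intros]:
  "continuous_on {0..} pay_S" "continuous_on {0..} pay_u" "continuous_on {0..} drift"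
  unfolding pay_S_def pay_u_def skill_drift_def by (intro continuous_intros cont_u cont_S)+

text \<open>Since usage is continuous in time, so is the drift, and the integral form of the state
  equation becomes a classical derivative, one-sided at the end points.\<close>

lemma S_deriv:
  assumes "t \<in> {0..T}"
  shows "(S has_real_derivative drift t) (at t within {0..T})"
proof -
  have "((\<lambda>t. S 0 + integral {0..t} drift) has_real_derivative drift t) (at t within {0..T})"
    using assms by (auto intro!: derivative_eq_intros integral_has_real_derivative
      continuous_on_subset[OF continuous_pay(3)])
  then show ?thesis
    by (rule has_field_derivative_transform_within[OF _ zero_less_one assms])
      (auto dest!: drift_integral simp: integral_unique)
qed

text \<open>Needed to split the payoff of a perturbed path into separate integrals. Skill and usage
  are bounded, so a multiple of the discount factor dominates.\<close>

lemma set_integrable_payoff: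
  "set_integrable lborel {0..} (\<lambda>t. exp (- \<delta> * t) * worker_payoff \<alpha> \<beta> \<gamma> \<omega> (S t) (u t))"
proof -
  define M where "M = Sbar + (\<bar>\<alpha>\<bar> + \<bar>\<beta>\<bar> * Sbar + \<gamma>) + \<bar>\<omega>\<bar> * Sbar"
  have meas: "set_borel_measurable lborel {0..} f" if "continuous_on {0..} f" for f :: "real \<Rightarrow> real"
    unfolding set_borel_measurable_def using borel_measurable_continuous_on_indicator[OF _ that]
    by simp
  \<comment> \<open>Gauge integrability of a nonnegative function gives integrability for the
    completed measure; Borel measurability then carries it back to \<open>lborel\<close>.\<close>
  have "(\<lambda>t. exp (- \<delta> * t)) absolutely_integrable_on {0..}"
    using pos by (intro nonnegative_absolutely_integrable_1 integrable_on_exp_minus_to_infinity) auto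
  then have "set_integrable lborel {0..} (\<lambda>t. exp (- \<delta> * t))"
    using meas[of "\<lambda>t. exp (- \<delta> * t)"]
    by (auto simp: set_integrable_def set_borel_measurable_def integrable_completion intro!: continuous_intros)
  then have "set_integrable lborel {0..} (\<lambda>t. exp (- \<delta> * t) * M)"
    by auto
  then show ?thesis
  proof (rule set_integrable_bound)
    show "set_borel_measurable lborel {0..} (\<lambda>t. exp (- \<delta> * t) * worker_payoff \<alpha> \<beta> \<gamma> \<omega> (S t) (u t))"
      unfolding worker_payoff_def productivity_def
      by (intro meas continuous_intros cont_u cont_S)
    have "\<bar>worker_payoff \<alpha> \<beta> \<gamma> \<omega> (S t) (u t)\<bar> \<le> M" if "0 \<le> t" for t
    proof -
      have S: "\<bar>S t\<bar> \<le> Sbar" and u: "\<bar>u t\<bar> \<le> 1" "\<bar>1 - u t\<bar> \<le> 1"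
        using S_range[OF that] interior[OF that] by auto
      have "\<bar>(1 - u t) * S t\<bar> \<le> 1 * Sbar"
        unfolding abs_mult using S u pos by (intro mult_mono) auto
      moreover have "\<bar>(\<alpha> + \<beta> * S t - \<gamma> * u t) * u t\<bar> \<le> (\<bar>\<alpha>\<bar> + \<bar>\<beta>\<bar> * Sbar + \<gamma>) * 1"
      proof -
        have "\<bar>\<beta> * S t\<bar> \<le> \<bar>\<beta>\<bar> * Sbar" "\<bar>\<gamma> * u t\<bar> \<le> \<gamma> * 1"
          using S u pos unfolding abs_mult by (auto intro!: mult_mono)
        then have "\<bar>\<alpha> + \<beta> * S t - \<gamma> * u t\<bar> \<le> \<bar>\<alpha>\<bar> + \<bar>\<beta>\<bar> * Sbar + \<gamma>"
          by linarith
        then show ?thesis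
          unfolding abs_mult using u pos by (intro mult_mono) auto
      qed
      moreover have "\<bar>\<omega> * S t\<bar> \<le> \<bar>\<omega>\<bar> * Sbar"
        unfolding abs_mult using S by (intro mult_left_mono) auto
      moreover have "\<bar>x + y + w\<bar> \<le> a + b + c" if "\<bar>x\<bar> \<le> a" "\<bar>y\<bar> \<le> b" "\<bar>w\<bar> \<le> c" for x y w a b c :: real
        using that by linarith
      ultimately show ?thesis
        unfolding worker_payoff_def productivity_def M_def mult_1 mult_1_right by blast
    qed
    then show "AE t in lborel. t \<in> {0..} \<longrightarrow>
        norm (exp (- \<delta> * t) * worker_payoff \<alpha> \<beta> \<gamma> \<omega> (S t) (u t)) \<le> norm (exp (- \<delta> * t) * M)"
      by (auto simp: abs_mult intro: order_trans[OF _ abs_ge_self])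
  qed
qed

text \<open>Skill is shifted by \<open>x * h\<close> and usage by \<open>x * k\<close>. Mean zero of
  \<open>g\<close> makes the shifted path rejoin the optimal one at \<open>T\<close>. For small
  \<open>x\<close> of either sign this is admissible, and the payoff changes by exactly
  \<open>x * A + x\<^sup>2 * B\<close>, so optimality gives \<open>A = 0\<close>. The claim is this
  equation with \<open>k\<close> eliminated.\<close>

lemma first_variation:
  assumes T: "0 < T" and g: "continuous_on {0..T} g" and g0: "integral {0..T} g = 0"
  shows "integral {0..T} (\<lambda>t. exp (- \<delta> * t) * (pay_S t - pay_u t / Sbar) * integral {0..t} g
    + - exp (- \<delta> * t) * pay_u t / (\<kappa> * Sbar) * g t) = 0"
proof -
  define h where "h t = (if t \<in> {0..T} then integral {0..t} g else 0)" for t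
  \<comment> \<open>\<open>k\<close> is the change of usage that moves the skill path by \<open>h\<close>. At \<open>T\<close> the perturbed usage may jump,
    but \<open>h\<close> vanishes there because \<open>g\<close> has integral 0.\<close>
  define k where "k t = (if t \<in> {0..T} then - (g t + \<kappa> * h t) / (\<kappa> * Sbar) else 0)" for t
  have h_in: "h t = integral {0..t} g" and k_in: "k t = - (g t + \<kappa> * h t) / (\<kappa> * Sbar)"
    if "t \<in> {0..T}" for t
    using that by (simp_all add: h_def k_def)
  have h_out: "h t = 0" and k_out: "k t = 0" if "T < t" for t
    using that by (simp_all add: h_def k_def)
  have "h 0 = 0" by (simp add: h_def)
  have dh: "(h has_real_derivative g t) (at t within {0..T})" if "t \<in> {0..T}" for t
    by (rule has_field_derivative_transform_within[OF integral_has_real_derivative[OF g that] zero_less_one that])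
      (simp add: h_in)
  have ch: "continuous_on {0..T} h"
    using dh DERIV_continuous_on by blast
  have "continuous_on {0..T} (\<lambda>t. - (g t + \<kappa> * h t) / (\<kappa> * Sbar))"
    using pos by (intro continuous_intros g ch) auto
  then have ck: "continuous_on {0..T} k"
    by (rule continuous_on_eq) (simp add: k_in)
  have sub: "continuous_on {0..T} f" if "continuous_on {0..} f" for f :: "real \<Rightarrow> real"
    using that by (rule continuous_on_subset) auto

  obtain e where e: "0 < e"
    and v_range: "\<And>x t. \<bar>x\<bar> \<le> e \<Longrightarrow> 0 \<le> t \<Longrightarrow> u t + x * k t \<in> {0..1}"
  proof -
    \<comment> \<open>\<open>\<phi> t\<close> bounds the sizes of \<open>x\<close> that keep usage
      in \<open>{0..1}\<close> at time \<open>t\<close>; the added 1 avoids division by zero.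
      Interior usage and compactness of \<open>{0..T}\<close> give it a positive minimum.\<close>
    define \<phi> where "\<phi> t = min (u t) (1 - u t) / (1 + \<bar>k t\<bar>)" for t
    have "continuous_on {0..T} \<phi>"
      unfolding \<phi>_def by (intro continuous_intros ck sub[OF cont_u]) (auto simp: add_nonneg_eq_0_iff)
    then obtain t0 where t0: "t0 \<in> {0..T}" and min: "\<And>t. t \<in> {0..T} \<Longrightarrow> \<phi> t0 \<le> \<phi> t"
      using continuous_attains_inf[of "{0..T}" \<phi>] T by auto
    have "0 < \<phi> t0"
      using interior[of t0] t0 by (auto simp: \<phi>_def intro!: divide_pos_pos)
    moreover have "u t + x * k t \<in> {0..1}" if x: "\<bar>x\<bar> \<le> \<phi> t0" and t: "0 \<le> t" for x t
    proof (cases "t \<le> T")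
      case True
      have "\<bar>x * k t\<bar> \<le> \<bar>x\<bar> * (1 + \<bar>k t\<bar>)"
        unfolding abs_mult by (intro mult_left_mono) auto
      also have "\<dots> \<le> \<phi> t * (1 + \<bar>k t\<bar>)"
        using x min[of t] True t by (intro mult_right_mono) auto
      also have "\<dots> = min (u t) (1 - u t)"
        by (simp add: \<phi>_def add_nonneg_eq_0_iff)
      finally show ?thesis by auto
    qed (use interior[OF t] k_out in auto)
    ultimately show ?thesis using that by blast
  qed

  have adm_pert: "admissible \<kappa> Sbar (S 0) (\<lambda>t. S t + x * h t) (\<lambda>t. u t + x * k t)"
    if x: "\<bar>x\<bar> \<le> e" for x
  proof -
    \<comment> \<open>Perturbed usage may jump at \<open>T\<close>, so measurability is assembled
      from two pieces continuous on their own intervals.\<close>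
    have "(\<lambda>t. indicator {0..T} t *\<^sub>R k t) \<in> borel_measurable borel"
      using borel_measurable_continuous_on_indicator[OF _ ck] by simp
    moreover have "(\<lambda>t. indicator {0..} t *\<^sub>R u t) \<in> borel_measurable borel"
      using borel_measurable_continuous_on_indicator[OF _ cont_u] by simp
    ultimately have "(\<lambda>t. indicator {0..} t *\<^sub>R u t + x * (indicator {0..T} t *\<^sub>R k t))
        \<in> borel_measurable borel"
      by measurable
    also have "(\<lambda>t. indicator {0..} t *\<^sub>R u t + x * (indicator {0..T} t *\<^sub>R k t)) =
        (\<lambda>t. indicator {0..} t *\<^sub>R (u t + x * k t))"
      using k_out by (auto simp: indicator_def fun_eq_iff)
    finally have meas: "set_borel_measurable lborel {0..} (\<lambda>t. u t + x * k t)"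
      by (simp add: set_borel_measurable_def)
    have drift_eq: "skill_drift \<kappa> Sbar (S t + x * h t) (u t + x * k t)
        = drift t + x * (if t \<in> {0..T} then g t else 0)" if "0 \<le> t" for t
    proof -
      have "\<kappa> * Sbar * k t + \<kappa> * h t = - (if t \<in> {0..T} then g t else 0)"
        using pos k_out[of t] h_out[of t] k_in[of t] that by (auto simp: field_simps)
      moreover have "skill_drift \<kappa> Sbar (S t + x * h t) (u t + x * k t)
          = drift t - x * (\<kappa> * Sbar * k t + \<kappa> * h t)"
        by (simp add: skill_drift_def algebra_simps)
      ultimately show ?thesis by simp
    qed
    have range: "S t + x * h t \<in> {0..Sbar}" if t: "0 \<le> t" for t
    proof (cases "t \<le> T")
      case True
      show ?thesis
      proof (rule skill_path_bounds[where T = T and X = "\<lambda>t. S t + x * h t" and t = t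
          and v = "\<lambda>t. u t + x * k t"])
        fix s assume s: "s \<in> {0..T}"
        show "((\<lambda>t. S t + x * h t) has_real_derivative
            skill_drift \<kappa> Sbar (S s + x * h s) (u s + x * k s)) (at s within {0..T})"
          using s drift_eq[of s] by (auto intro!: derivative_eq_intros S_deriv dh)
        show "u s + x * k s \<in> {0..1}" using v_range[OF x] s by simp
      next
        show "S 0 + x * h 0 \<in> {0..Sbar}" using S_range[of 0] \<open>h 0 = 0\<close> by simp
        show "t \<in> {0..T}" using True t by simp
      qed (use pos in auto)
    qed (use S_range[OF t] h_out in auto)
    have int: "((\<lambda>s. skill_drift \<kappa> Sbar (S s + x * h s) (u s + x * k s))
        has_integral (S t + x * h t - S 0)) {0..t}" if t: "0 \<le> t" for t
    proof -
      have "((\<lambda>s. if s \<in> {0..T} then g s else 0) has_integral h t) {0..t}"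
      proof (cases "t \<le> T")
        case True
        then have "(g has_integral h t) {0..t}"
          using t g by (auto simp: h_in intro!: integrable_integral integrable_continuous_real
            intro: continuous_on_subset)
        then show ?thesis
          by (rule has_integral_eq[rotated]) (use True in auto)
      next
        case False
        \<comment> \<open>Beyond \<open>T\<close> the cut-off \<open>g\<close> has contributed its
          whole integral, which is 0, in agreement with \<open>h t = 0\<close>.\<close>
        have "(g has_integral h t) {0..T}"
          using False g0 g h_out[of t] integrable_integral[OF integrable_continuous_real[OF g]] by simp
        then show ?thesis
          using False by (subst has_integral_restrict) auto
      qed
      from has_integral_add[OF drift_integral[OF t] has_integral_mult_right[OF this, of x]]
      show ?thesis
        by (rule has_integral_eq_rhs[OF has_integral_eq, rotated]) (auto simp: drift_eq)
    qed
    show ?thesis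
      unfolding admissible_def using meas range v_range[OF x] int by blast
  qed

  define a where "a t = exp (- \<delta> * t) * (pay_S t * h t + pay_u t * k t)" for t
  define b where "b t = exp (- \<delta> * t) * ((\<beta> - 1) * h t * k t - \<gamma> * (k t)\<^sup>2)" for t
  define A where "A = (LBINT t:{0..}. a t)"
  define B where "B = (LBINT t:{0..}. b t)"
  \<comment> \<open>The first- and second-order integrands \<open>a\<close> and \<open>b\<close>
    vanish after \<open>T\<close>, so their half-line integrals reduce to integrals of continuous
    functions over \<open>{0..T}\<close>.\<close>
  have local_int: "set_integrable lborel {0..} f" "(LBINT t:{0..}. f t) = integral {0..T} f"
    if "continuous_on {0..T} f" and "\<And>t. T < t \<Longrightarrow> f t = 0" for f :: "real \<Rightarrow> real"
  proof -
    have eq: "indicator {0..} t *\<^sub>R f t = indicator {0..T} t *\<^sub>R f t" for t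
      using that(2)[of t] by (auto simp: indicator_def)
    have *: "set_integrable lborel {0..T} f"
      by (rule borel_integrable_atLeastAtMost'[OF that(1)])
    then show "set_integrable lborel {0..} f"
      unfolding set_integrable_def eq .
    show "(LBINT t:{0..}. f t) = integral {0..T} f"
      unfolding set_borel_integral_eq_integral(2)[OF *, symmetric] set_lebesgue_integral_def eq ..
  qed
  have ca: "continuous_on {0..T} a" and cb: "continuous_on {0..T} b"
    unfolding a_def b_def by (intro continuous_intros ch ck sub[OF continuous_pay(1)] sub[OF continuous_pay(2)])+
  have int_a: "set_integrable lborel {0..} a" and int_b: "set_integrable lborel {0..} b"
    by (intro local_int ca cb; simp add: a_def b_def h_out k_out)+
  have "x * A + x\<^sup>2 * B \<le> 0" if x: "\<bar>x\<bar> \<le> e" for x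
  proof -
    let ?f = "worker_payoff \<alpha> \<beta> \<gamma> \<omega>"
    have int_x: "set_integrable lborel {0..} (\<lambda>t. x * a t)"
      "set_integrable lborel {0..} (\<lambda>t. x\<^sup>2 * b t)"
      using int_a int_b by auto
    have "discounted_payoff \<delta> ?f (\<lambda>t. S t + x * h t) (\<lambda>t. u t + x * k t) =
        (LBINT t:{0..}. exp (- \<delta> * t) * ?f (S t) (u t) + x * a t + x\<^sup>2 * b t)"
      unfolding discounted_payoff_def
      by (simp add: worker_payoff_expand a_def b_def pay_S_def pay_u_def algebra_simps)
    also have "\<dots> = discounted_payoff \<delta> ?f S u + x * A + x\<^sup>2 * B"
      using set_integrable_payoff int_x
      by (simp add: discounted_payoff_def A_def B_def)
    finally show ?thesis
      using opt[OF adm_pert[OF x]] by simp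
  qed
  then have "A = 0"
    by (rule quadratic_max_imp_linear_coeff_zero[OF e])
  moreover have "A = integral {0..T} a"
    unfolding A_def by (intro local_int ca) (simp add: a_def h_out k_out)
  \<comment> \<open>Inserting the formula for \<open>k\<close> sorts the integrand into a multiple
    of \<open>h\<close> and a multiple of \<open>g\<close>, the shape required by
    \<open>du_bois_reymond\<close>.\<close>
  moreover have "integral {0..T} a = integral {0..T} (\<lambda>t. exp (- \<delta> * t) * (pay_S t - pay_u t / Sbar)
      * integral {0..t} g + - exp (- \<delta> * t) * pay_u t / (\<kappa> * Sbar) * g t)"
    using pos by (intro integral_cong) (simp add: a_def k_in flip: h_in, simp add: field_simps)
  ultimately show ?thesis by simp
qed

text \<open>The costate equation: \<open>pay_u / (\<kappa> * Sbar)\<close> plays the role of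
  \<open>V'(S)\<close>. Usage is only known to be continuous, so differentiability itself has to
  come from \<open>du_bois_reymond\<close>, which expresses \<open>pay_u\<close> through the
  integral of a continuous function.\<close>

lemma pay_u_deriv:
  assumes T: "0 < T" and t: "t \<in> {0..T}"
  shows "(pay_u has_real_derivative (\<delta> + \<kappa>) * pay_u t - \<kappa> * Sbar * pay_S t) (at t within {0..T})"
proof -
  let ?F = "\<lambda>t. exp (- \<delta> * t) * (pay_S t - pay_u t / Sbar)"
  let ?G = "\<lambda>t. - exp (- \<delta> * t) * pay_u t / (\<kappa> * Sbar)"
  have sub: "continuous_on {0..T} f" if "continuous_on {0..} f" for f :: "real \<Rightarrow> real"
    using that by (rule continuous_on_subset) auto
  have F: "continuous_on {0..T} ?F" and G: "continuous_on {0..T} ?G"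
    using pos by (intro continuous_intros sub[OF continuous_pay(1)] sub[OF continuous_pay(2)]; simp)+
  obtain c where c: "\<And>t. t \<in> {0..T} \<Longrightarrow> ?G t = c + integral {0..t} ?F"
    using du_bois_reymond[OF T F G first_variation[OF T]] by blast
  have eq: "- (\<kappa> * Sbar) * exp (\<delta> * s) * (c + integral {0..s} ?F) = pay_u s" if "s \<in> {0..T}" for s
    using pos unfolding c[OF that, symmetric] by (simp add: exp_minus)
  have "((\<lambda>s. - (\<kappa> * Sbar) * exp (\<delta> * s) * (c + integral {0..s} ?F)) has_real_derivative
      - (\<kappa> * Sbar) * exp (\<delta> * t) * ?F t
      + \<delta> * (- (\<kappa> * Sbar) * exp (\<delta> * t) * (c + integral {0..t} ?F))) (at t within {0..T})"
    by (rule derivative_eq_intros refl integral_has_real_derivative[OF F t])+ (simp add: algebra_simps)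
  also have "- (\<kappa> * Sbar) * exp (\<delta> * t) * ?F t
      + \<delta> * (- (\<kappa> * Sbar) * exp (\<delta> * t) * (c + integral {0..t} ?F))
      = (\<delta> + \<kappa>) * pay_u t - \<kappa> * Sbar * pay_S t"
    unfolding eq[OF t] using pos by (simp add: exp_minus field_simps)
  finally show ?thesis
    by (rule has_field_derivative_transform_within[OF _ zero_less_one t]) (rule eq)
qed

text \<open>The second-order equation for skill. The externality \<open>\<omega>\<close> enters only
  its constant term, which is why it shifts the policy but leaves the slope unchanged.\<close>

lemma drift_deriv:
  assumes T: "0 < T" and t: "t \<in> {0..T}"
  shows "(drift has_real_derivative \<delta> * drift t
      + (\<kappa> * (\<delta> + \<kappa>) + \<kappa> * Sbar * (\<beta> - 1) * (\<delta> + 2 * \<kappa>) / (2 * \<gamma>)) * S t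
      + \<kappa> * Sbar * ((\<delta> + \<kappa>) * (\<alpha> - 2 * \<gamma>) - \<kappa> * Sbar * (\<beta> + \<omega>)) / (2 * \<gamma>))
    (at t within {0..T})"
proof -
  \<comment> \<open>Usage is replaced by skill and \<open>pay_u\<close>, whose derivatives are
    already known.\<close>
  have eq: "drift = (\<lambda>t. \<kappa> * Sbar * (1 - (\<alpha> + (\<beta> - 1) * S t - pay_u t) / (2 * \<gamma>)) - \<kappa> * S t)"
    using pos by (auto simp: fun_eq_iff skill_drift_def pay_u_def field_simps)
  have "(drift has_real_derivative
      \<kappa> * Sbar * (- ((\<beta> - 1) * drift t - ((\<delta> + \<kappa>) * pay_u t - \<kappa> * Sbar * pay_S t)) / (2 * \<gamma>))
      - \<kappa> * drift t) (at t within {0..T})"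
    by (subst eq) (rule derivative_eq_intros refl S_deriv[OF t] pay_u_deriv[OF T t]
      | use pos in \<open>simp add: field_simps\<close>)+
  then show ?thesis
    by (rule back_subst[where P = "\<lambda>d. (drift has_real_derivative d) (at t within {0..T})"])
      (use pos in \<open>simp add: skill_drift_def pay_u_def pay_S_def field_simps\<close>)
qed

text \<open>\<open>l1\<close> and \<open>l2\<close> are the characteristic roots, given by their sum
  and product. Factoring the second-order operator leaves \<open>z' = l2 * z + K\<close> for
  \<open>z = drift - l1 * S\<close>; as \<open>z\<close> is bounded and \<open>l2\<close> positive,
  \<open>z 0\<close> is determined.\<close>

lemma initial_drift_affine:
  assumes sum: "l1 + l2 = \<delta>"
    and prod: "l1 * l2 = - (\<kappa> * (\<delta> + \<kappa>) + \<kappa> * Sbar * (\<beta> - 1) * (\<delta> + 2 * \<kappa>) / (2 * \<gamma>))"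
    and l2: "0 < l2"
  shows "drift 0 = l1 * S 0
    - \<kappa> * Sbar * ((\<delta> + \<kappa>) * (\<alpha> - 2 * \<gamma>) - \<kappa> * Sbar * (\<beta> + \<omega>)) / (2 * \<gamma>) / l2"
proof -
  define K where "K = \<kappa> * Sbar * ((\<delta> + \<kappa>) * (\<alpha> - 2 * \<gamma>) - \<kappa> * Sbar * (\<beta> + \<omega>)) / (2 * \<gamma>)"
  define z where "z t = drift t - l1 * S t" for t
  have "z 0 = - K / l2"
  proof (rule bounded_linear_ode_initial[OF l2])
    fix T t :: real assume T: "0 < T" and t: "t \<in> {0..T}"
    have "(z has_real_derivative \<delta> * drift t + - (l1 * l2) * S t + K - l1 * drift t)
        (at t within {0..T})"
      unfolding z_def K_def prod
      by (rule derivative_eq_intros refl drift_deriv[OF T t] S_deriv[OF t])+ simp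
    also have "\<delta> * drift t + - (l1 * l2) * S t + K - l1 * drift t = l2 * z t + K"
      unfolding z_def sum[symmetric] by (simp add: algebra_simps)
    finally show "(z has_real_derivative l2 * z t + K) (at t within {0..T})" .
  next
    fix t :: real assume t: "0 \<le> t"
    have S: "\<bar>S t\<bar> \<le> Sbar" and u: "\<bar>1 - u t\<bar> \<le> 1"
      using S_range[OF t] interior[OF t] by auto
    have "\<bar>\<kappa> * Sbar * (1 - u t)\<bar> \<le> \<kappa> * Sbar * 1" "\<bar>\<kappa> * S t\<bar> \<le> \<kappa> * Sbar" "\<bar>l1 * S t\<bar> \<le> \<bar>l1\<bar> * Sbar"
      unfolding abs_mult using S u pos by (auto intro!: mult_mono)
    then show "\<bar>z t\<bar> \<le> \<kappa> * Sbar + \<kappa> * Sbar + \<bar>l1\<bar> * Sbar"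
      unfolding z_def skill_drift_def by linarith
  qed
  then show ?thesis by (simp add: z_def K_def)
qed

end

section \<open>Closed forms of the policy coefficients\<close>

text \<open>Under an affine policy of slope \<open>u1\<close> the drift has slope
  \<open>- \<kappa> * (1 + u1 * Sbar)\<close> in skill; the formula identifies it with the smaller
  characteristic root.\<close>

lemma one_plus_u1_coef:
  assumes "0 < \<gamma>" "0 < \<kappa>" "0 < Sbar"
  shows "1 + u1_coef \<beta> \<gamma> \<kappa> \<delta> Sbar * Sbar = (sqrt (Ddisc \<beta> \<gamma> \<kappa> \<delta> Sbar) / \<gamma> - \<delta>) / (2 * \<kappa>)"
  using assms by (simp add: u1_coef_def acoef_def field_simps power2_eq_square)

lemma uomega_coef_pos:
  assumes "0 < \<gamma>" "0 < \<kappa>" "0 < \<delta>" "0 < Sbar" "0 \<le> Ddisc \<beta> \<gamma> \<kappa> \<delta> Sbar"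
  shows "0 < uomega_coef \<beta> \<gamma> \<kappa> \<delta> Sbar"
  using assms unfolding uomega_coef_def by (intro divide_pos_pos add_pos_nonneg) auto

text \<open>Removes the value-function coefficients from the intercept. The denominator is that of
  \<open>uomega_coef\<close>, so the effect of \<open>\<omega>\<close> later amounts to replacing
  \<open>\<beta>\<close> by \<open>\<beta> + \<omega>\<close> in the numerator.\<close>

lemma one_minus_u0_coef:
  assumes "0 < \<gamma>" "0 < \<kappa>" "0 < \<delta>" "0 < Sbar" "0 \<le> Ddisc \<beta> \<gamma> \<kappa> \<delta> Sbar"
  shows "1 - u0_coef \<alpha> \<beta> \<gamma> \<kappa> \<delta> Sbar =
    (\<kappa> * Sbar * \<beta> - (\<delta> + \<kappa>) * (\<alpha> - 2 * \<gamma>)) / (\<gamma> * \<delta> + sqrt (Ddisc \<beta> \<gamma> \<kappa> \<delta> Sbar))"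
proof -
  define s where "s = sqrt (Ddisc \<beta> \<gamma> \<kappa> \<delta> Sbar)"
  have s: "0 \<le> s" using assms by (simp add: s_def)
  then have den: "0 < \<gamma> * \<delta> + s" using assms by (intro add_pos_nonneg) auto
  define A where "A = \<kappa> * acoef \<beta> \<gamma> \<kappa> \<delta> Sbar * Sbar"
  have A: "2 * (\<kappa> * Sbar) * A = \<kappa> * ((\<beta> - 1) * Sbar + 2 * \<gamma>) + \<gamma> * \<delta> - s"
    using assms by (simp add: A_def acoef_def s_def field_simps power2_eq_square)
  have "bcoef \<alpha> \<beta> \<gamma> \<kappa> \<delta> Sbar =
      (2 * \<gamma> * (1 + 2 * A) + \<alpha> * (\<beta> - 1 - 2 * A)) /
      (2 * (\<delta> + \<kappa>) * \<gamma> + \<kappa> * (\<beta> - 1) * Sbar - 2 * (\<kappa> * Sbar) * A)"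
    by (simp add: bcoef_def Let_def A_def power2_eq_square mult_ac)
  \<comment> \<open>The stable root cancels everything in the denominator of \<open>bcoef\<close>
    except \<open>\<gamma> * \<delta> + s\<close>.\<close>
  also have "2 * (\<delta> + \<kappa>) * \<gamma> + \<kappa> * (\<beta> - 1) * Sbar - 2 * (\<kappa> * Sbar) * A = \<gamma> * \<delta> + s"
    unfolding A by (simp add: algebra_simps)
  finally have b: "(\<gamma> * \<delta> + s) * bcoef \<alpha> \<beta> \<gamma> \<kappa> \<delta> Sbar = 2 * \<gamma> * (1 + 2 * A) + \<alpha> * (\<beta> - 1 - 2 * A)"
    using den by simp
  have "2 * \<gamma> * ((\<gamma> * \<delta> + s) * (1 - u0_coef \<alpha> \<beta> \<gamma> \<kappa> \<delta> Sbar))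
      = (\<gamma> * \<delta> + s) * (2 * \<gamma> - \<alpha>) + \<kappa> * Sbar * ((\<gamma> * \<delta> + s) * bcoef \<alpha> \<beta> \<gamma> \<kappa> \<delta> Sbar)"
    using assms by (simp add: u0_coef_def field_simps)
  also have "\<dots> = (\<gamma> * \<delta> + s) * (2 * \<gamma> - \<alpha>) + \<kappa> * Sbar * (2 * \<gamma> + \<alpha> * (\<beta> - 1))
      + (2 * \<gamma> - \<alpha>) * (2 * (\<kappa> * Sbar) * A)"
    unfolding b by (simp add: algebra_simps)
  also have "\<dots> = 2 * \<gamma> * (\<kappa> * Sbar * \<beta> - (\<delta> + \<kappa>) * (\<alpha> - 2 * \<gamma>))"
    unfolding A by (simp add: algebra_simps)
  finally have "(\<gamma> * \<delta> + s) * (1 - u0_coef \<alpha> \<beta> \<gamma> \<kappa> \<delta> Sbar) = \<kappa> * Sbar * \<beta> - (\<delta> + \<kappa>) * (\<alpha> - 2 * \<gamma>)"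
    using assms(1) by simp
  then show ?thesis
    using den unfolding s_def[symmetric] by (simp add: nonzero_eq_divide_eq mult.commute)
qed

section \<open>The affine policy and its steady state\<close>

text \<open>Each starting skill \<open>x\<close> has its own optimal path. Its drift at time 0 is
  affine in \<open>x\<close> and also equals \<open>skill_drift \<kappa> Sbar x (pol x)\<close>,
  which can be solved for \<open>pol x\<close>.\<close>

lemma interior_optimal_policy_affine:
  assumes pos: "0 < \<gamma>" "0 < \<kappa>" "0 < \<delta>" "0 < Sbar" and D: "0 \<le> Ddisc \<beta> \<gamma> \<kappa> \<delta> Sbar"
    and opt: "optimal_policy \<kappa> \<delta> Sbar (worker_payoff \<alpha> \<beta> \<gamma> \<omega>) pol"
    and int: "interior_policy Sbar pol"
    and x: "x \<in> {0..Sbar}"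
  shows "pol x = u0_coef \<alpha> \<beta> \<gamma> \<kappa> \<delta> Sbar - uomega_coef \<beta> \<gamma> \<kappa> \<delta> Sbar * \<omega>
    + u1_coef \<beta> \<gamma> \<kappa> \<delta> Sbar * x"
proof -
  obtain S where adm: "admissible \<kappa> Sbar x S (\<lambda>t. pol (S t))"
    and max: "\<And>X v. admissible \<kappa> Sbar x X v \<Longrightarrow>
      discounted_payoff \<delta> (worker_payoff \<alpha> \<beta> \<gamma> \<omega>) X v
        \<le> discounted_payoff \<delta> (worker_payoff \<alpha> \<beta> \<gamma> \<omega>) S (\<lambda>t. pol (S t))"
    using opt x unfolding optimal_policy_def by blast
  have S0: "S 0 = x" by (rule admissible_initial[OF adm])
  have range: "S t \<in> {0..Sbar}" if "0 \<le> t" for t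
    using adm that by (simp add: admissible_def)
  interpret optimal_interior_path \<alpha> \<beta> \<gamma> \<kappa> \<delta> Sbar \<omega> S "\<lambda>t. pol (S t)"
  proof
    show "continuous_on {0..} (\<lambda>t. pol (S t))"
      using opt admissible_continuous_on[OF adm] range
      by (intro continuous_on_compose2[of "{0..Sbar}" pol "{0..}" S])
        (simp_all add: optimal_policy_def image_subset_iff)
    show "0 < pol (S t) \<and> pol (S t) < 1" if "0 \<le> t" for t
      using int range[OF that] by (simp add: interior_policy_def)
  qed (use pos adm max S0 in auto)
  define s where "s = sqrt (Ddisc \<beta> \<gamma> \<kappa> \<delta> Sbar)"
  have s: "0 \<le> s" and ss: "s * s = Ddisc \<beta> \<gamma> \<kappa> \<delta> Sbar"
    using D by (simp_all add: s_def)
  have den: "0 < \<gamma> * \<delta> + s"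
    using pos s by (intro add_pos_nonneg) auto
  define K where "K = \<kappa> * Sbar * (\<beta> + \<omega>) - (\<delta> + \<kappa>) * (\<alpha> - 2 * \<gamma>)"
  \<comment> \<open>The candidate roots have sum \<open>\<delta>\<close>; in their product the
    squares of \<open>\<beta> - 1\<close> inside \<open>Ddisc\<close> cancel.\<close>
  have "(\<delta> - s / \<gamma>) / 2 * ((\<delta> + s / \<gamma>) / 2) = (\<delta>\<^sup>2 - s * s / \<gamma>\<^sup>2) / 4"
    by (simp add: algebra_simps power2_eq_square)
  also have "\<dots> = - (\<kappa> * (\<delta> + \<kappa>) + \<kappa> * Sbar * (\<beta> - 1) * (\<delta> + 2 * \<kappa>) / (2 * \<gamma>))"
    unfolding ss Ddisc_def using pos by (simp add: field_simps power2_eq_square)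
  finally have prod: "(\<delta> - s / \<gamma>) / 2 * ((\<delta> + s / \<gamma>) / 2) =
      - (\<kappa> * (\<delta> + \<kappa>) + \<kappa> * Sbar * (\<beta> - 1) * (\<delta> + 2 * \<kappa>) / (2 * \<gamma>))" .
  have sum: "(\<delta> - s / \<gamma>) / 2 + (\<delta> + s / \<gamma>) / 2 = \<delta>"
    by (simp flip: add_divide_distrib)
  have "0 < (\<delta> + s / \<gamma>) / 2"
    using pos s by (intro divide_pos_pos add_pos_nonneg) auto
  from initial_drift_affine[OF sum prod this]
  have "skill_drift \<kappa> Sbar x (pol x) = (\<delta> - s / \<gamma>) / 2 * x
      - \<kappa> * Sbar * ((\<delta> + \<kappa>) * (\<alpha> - 2 * \<gamma>) - \<kappa> * Sbar * (\<beta> + \<omega>)) / (2 * \<gamma>) / ((\<delta> + s / \<gamma>) / 2)"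
    unfolding S0 .
  also have "\<dots> = (\<delta> - s / \<gamma>) / 2 * x + \<kappa> * Sbar * (K / (\<gamma> * \<delta> + s))"
  proof -
    have l2: "(\<delta> + s / \<gamma>) / 2 = (\<gamma> * \<delta> + s) / (2 * \<gamma>)"
      using pos by (simp add: field_simps)
    have K: "(\<delta> + \<kappa>) * (\<alpha> - 2 * \<gamma>) - \<kappa> * Sbar * (\<beta> + \<omega>) = - K"
      by (simp add: K_def)
    show ?thesis
      unfolding l2 K using pos den by (simp add: field_simps)
  qed
  also have "K / (\<gamma> * \<delta> + s) = 1 - u0_coef \<alpha> \<beta> \<gamma> \<kappa> \<delta> Sbar + uomega_coef \<beta> \<gamma> \<kappa> \<delta> Sbar * \<omega>"
    unfolding one_minus_u0_coef[OF pos D] uomega_coef_def K_def s_def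
    by (simp add: add_divide_distrib diff_divide_distrib algebra_simps)
  also have "(\<delta> - s / \<gamma>) / 2 = - \<kappa> * (1 + u1_coef \<beta> \<gamma> \<kappa> \<delta> Sbar * Sbar)"
    unfolding one_plus_u1_coef[OF pos(1,2,4)] s_def[symmetric] using pos by (simp add: field_simps)
  finally have "\<kappa> * Sbar * pol x = \<kappa> * Sbar * (u0_coef \<alpha> \<beta> \<gamma> \<kappa> \<delta> Sbar
      - uomega_coef \<beta> \<gamma> \<kappa> \<delta> Sbar * \<omega> + u1_coef \<beta> \<gamma> \<kappa> \<delta> Sbar * x)"
    by (simp add: skill_drift_def algebra_simps)
  then show ?thesis using pos by simp
qed

text \<open>Interiority at skill 0 and at \<open>Sbar\<close> gives
  \<open>0 < 1 - p < 1 + q * Sbar\<close>. Hence the denominator is positive and the unique zero of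
  the affine drift lies in the skill range.\<close>

lemma steady_state_of_affine_policy:
  assumes "0 < \<kappa>" "0 < Sbar" and int: "interior_policy Sbar pol"
    and pol: "\<And>x. x \<in> {0..Sbar} \<Longrightarrow> pol x = p + q * x"
  shows "is_steady_state \<kappa> Sbar pol x \<longleftrightarrow> x = Sbar * (1 - p) / (1 + q * Sbar)"
proof -
  have "0 < pol Sbar" "pol 0 < 1"
    using int assms(2) by (auto simp: interior_policy_def)
  then have lt: "0 < 1 - p" "1 - p < 1 + q * Sbar"
    using pol[of 0] pol[of Sbar] assms(2) by auto
  have drift: "skill_drift \<kappa> Sbar y (pol y) = \<kappa> * (Sbar * (1 - p) - y * (1 + q * Sbar))"
    if "y \<in> {0..Sbar}" for y
    using that by (simp add: skill_drift_def pol algebra_simps)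
  have "Sbar * (1 - p) / (1 + q * Sbar) \<in> {0..Sbar}"
    using lt assms(2) by (auto simp: divide_le_eq)
  moreover have "x = Sbar * (1 - p) / (1 + q * Sbar) \<longleftrightarrow> Sbar * (1 - p) - x * (1 + q * Sbar) = 0"
    using lt by (auto simp: eq_divide_eq)
  ultimately show ?thesis
    using assms(1) drift by (auto simp: is_steady_state_def)
qed

text \<open>\<open>\<Omega>\<close> holds the externality levels with interior policies. It cannot
  be the whole half-line, since usage falls linearly in \<open>\<omega>\<close> and would leave the
  unit interval.\<close>

theorem proposition6:
  fixes \<alpha> \<beta> \<gamma> \<kappa> \<delta> Sbar :: real
    and \<Omega> :: "real set"
    and ustar :: "real \<Rightarrow> real \<Rightarrow> real"
    and ufirm :: "real \<Rightarrow> real"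
  defines "u0 \<equiv> u0_coef \<alpha> \<beta> \<gamma> \<kappa> \<delta> Sbar"
    and "u1 \<equiv> u1_coef \<beta> \<gamma> \<kappa> \<delta> Sbar"
    and "u\<omega> \<equiv> uomega_coef \<beta> \<gamma> \<kappa> \<delta> Sbar"
  assumes "\<alpha> > 0" "\<beta> > 0" "\<gamma> > 0" "\<kappa> > 0" "\<delta> > 0" "Sbar > 0"
    and "Ddisc \<beta> \<gamma> \<kappa> \<delta> Sbar > 0"
    and "\<Omega> \<subseteq> {0..}" and "0 \<in> \<Omega>"
    and "\<And>\<omega>. \<omega> \<in> \<Omega> \<Longrightarrow> optimal_policy \<kappa> \<delta> Sbar (worker_payoff \<alpha> \<beta> \<gamma> \<omega>) (ustar \<omega>)"
    and "\<And>\<omega>. \<omega> \<in> \<Omega> \<Longrightarrow> interior_policy Sbar (ustar \<omega>)"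
    and "optimal_policy \<kappa> \<delta> Sbar (productivity \<alpha> \<beta> \<gamma>) ufirm"
    and "interior_policy Sbar ufirm"
  shows "(\<forall>\<omega>\<in>\<Omega>. \<forall>S\<in>{0..Sbar}. ustar \<omega> S = u0 - u\<omega> * \<omega> + u1 * S)
    \<and> u\<omega> > 0
    \<and> (\<forall>S\<in>{0..Sbar}. ustar 0 S = u0 + u1 * S)
    \<and> (\<forall>S\<in>{0..Sbar}. ustar 0 S = ufirm S)
    \<and> (\<forall>\<omega>\<in>\<Omega>. (\<exists>!S. is_steady_state \<kappa> Sbar (ustar \<omega>) S) \<and>
         steady_state_skill \<kappa> Sbar (ustar \<omega>) = Sbar * (1 - u0 + u\<omega> * \<omega>) / (1 + u1 * Sbar))
    \<and> (1 + u1 * Sbar > 0 \<longrightarrow>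
         strict_mono_on \<Omega> (\<lambda>\<omega>. steady_state_skill \<kappa> Sbar (ustar \<omega>)))"
proof -
  note pos = \<open>\<gamma> > 0\<close> \<open>\<kappa> > 0\<close> \<open>\<delta> > 0\<close> \<open>Sbar > 0\<close>
  have D: "0 \<le> Ddisc \<beta> \<gamma> \<kappa> \<delta> Sbar"
    using assms by simp
  have affine: "ustar \<omega> S = u0 - u\<omega> * \<omega> + u1 * S" if "\<omega> \<in> \<Omega>" "S \<in> {0..Sbar}" for \<omega> S
    unfolding u0_def u1_def u\<omega>_def
    using assms that by (intro interior_optimal_policy_affine[OF pos D]) auto
  \<comment> \<open>The firm's problem is the worker's at \<open>\<omega> = 0\<close>. The two
    optimal policies are given separately and agree because both equal the same affine
    function.\<close>
  have "worker_payoff \<alpha> \<beta> \<gamma> 0 = productivity \<alpha> \<beta> \<gamma>"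
    by (simp add: worker_payoff_def fun_eq_iff)
  then have firm: "ufirm S = u0 + u1 * S" if "S \<in> {0..Sbar}" for S
    using interior_optimal_policy_affine[OF pos D, of \<alpha> 0 ufirm S] assms that by auto
  have u\<omega>: "u\<omega> > 0"
    unfolding u\<omega>_def by (rule uomega_coef_pos[OF pos D])
  have steady: "is_steady_state \<kappa> Sbar (ustar \<omega>) S \<longleftrightarrow>
      S = Sbar * (1 - u0 + u\<omega> * \<omega>) / (1 + u1 * Sbar)" if "\<omega> \<in> \<Omega>" for \<omega> S
    using steady_state_of_affine_policy[of \<kappa> Sbar "ustar \<omega>" "u0 - u\<omega> * \<omega>" u1 S]
      affine[OF that] assms that by (simp add: algebra_simps)
  then have skill: "steady_state_skill \<kappa> Sbar (ustar \<omega>) = Sbar * (1 - u0 + u\<omega> * \<omega>) / (1 + u1 * Sbar)"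
    if "\<omega> \<in> \<Omega>" for \<omega>
    using that by (simp add: steady_state_skill_def)
  have "strict_mono_on \<Omega> (\<lambda>\<omega>. steady_state_skill \<kappa> Sbar (ustar \<omega>))" if "1 + u1 * Sbar > 0"
    using that pos u\<omega> by (auto intro!: strict_mono_onI divide_strict_right_mono simp: skill)
  then show ?thesis
    using affine firm u\<omega> steady skill \<open>0 \<in> \<Omega>\<close> by auto
qed

end
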